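(* Let $n$ be a positive integer and let $\tau_1,\dots,\tau_n$ be the automorphisms of $\mathfrak{sl}(n+1,\mathbb{C})$ defined by $\tau_i=\exp(\operatorname{ad}_{e_i})\exp(\operatorname{ad}_{(-f_i)})\exp(\operatorname{ad}_{e_i})$. Then for any $1\leq i\neq j\leq n$ the following relations hold: $$\underbrace{\tau_i\tau_j\cdots}_{m_{ij}}=\underbrace{\tau_j\tau_i\cdots}_{m_{ij}},$$ $$\tau_i^2\tau_j^2=\tau_j^2\tau_i^2,$$ $$\tau_i^4=1,$$ $$\tau_i\tau_j^2\tau_i^{-1}=\tau_j^2\tau_i^{-2\alpha_j(h_i)},$$ where each side of the first relation is an alternating product with $m_{ij}$ factors, $m_{ij}=3$ if $|i-j|=1$ and $m_{ij}=2$ if $|i-j|\geq 2$.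
   Context: $\mathfrak{sl}(n+1,\mathbb{C})$ is the Lie algebra of complex $(n+1)\times(n+1)$ matrices of trace zero, with bracket $[x,y]=xy-yx$. $E_{i,j}$ denotes the standard matrix units. For $1\le i\le n$: $e_i=E_{i,i+1}$, $f_i=E_{i+1,i}$, $h_i=E_{i,i}-E_{i+1,i+1}$. $\operatorname{ad}_x=[x,-]$ is the adjoint representation, and $\exp$ of an endomorphism is the usual power series $\exp(X)=\sum_{m\ge 0}X^m/m!$. $\mathfrak{h}=\bigoplus_{i=1}^n\mathbb{C}h_i$ is the Cartan subalgebra of diagonal trace-zero matrices; $\varepsilon_i\in\mathfrak{h}^*$ sends a diagonal matrix to its $i$-th diagonal entry, and $\alpha_j=\varepsilon_j-\varepsilon_{j+1}$ for $1\le j\le n$ are the simple roots. Products of the $\tau_i$ are compositions of maps, and $1$ denotes the identity automorphism. *)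

theory Defs
  imports Complex_Main "HOL-Algebra.Bij" "Jordan_Normal_Form.Matrix"
begin

text \<open>
  Matrices are those of \<^theory>\<open>Jordan_Normal_Form.Matrix\<close>, whose entries are
  indexed from \<open>0\<close>. The indices \<open>i\<close>, \<open>j\<close> of matrix units, Chevalley generators,
  weights and roots below are counted from \<open>1\<close>; in \<open>chev_e\<close>, \<open>chev_f\<close>,
  \<open>chev_h\<close> and \<open>tau\<close> the first argument \<open>n\<close> is the rank, so that the matrices
  have size \<open>n + 1\<close>.
\<close>

definition mat_trace :: "complex mat \<Rightarrow> complex" where
  "mat_trace A = (\<Sum>k<dim_row A. A $$ (k, k))"

definition sl :: "nat \<Rightarrow> complex mat set" where
  "sl m = {A \<in> carrier_mat m m. mat_trace A = 0}"

definition bracket :: "complex mat \<Rightarrow> complex mat \<Rightarrow> complex mat" where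
  "bracket x y = x * y - y * x"

abbreviation ad :: "complex mat \<Rightarrow> complex mat \<Rightarrow> complex mat" where
  "ad x \<equiv> bracket x"

definition matrix_unit :: "nat \<Rightarrow> nat \<Rightarrow> nat \<Rightarrow> complex mat" where
  "matrix_unit m i j = mat m m (\<lambda>(a, b). if a + 1 = i \<and> b + 1 = j then 1 else 0)"

definition chev_e :: "nat \<Rightarrow> nat \<Rightarrow> complex mat" where
  "chev_e n i = matrix_unit (n + 1) i (i + 1)"

definition chev_f :: "nat \<Rightarrow> nat \<Rightarrow> complex mat" where
  "chev_f n i = matrix_unit (n + 1) (i + 1) i"

definition chev_h :: "nat \<Rightarrow> nat \<Rightarrow> complex mat" where
  "chev_h n i = matrix_unit (n + 1) i i - matrix_unit (n + 1) (i + 1) (i + 1)"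

text \<open>
  The exponential of an endomorphism \<open>X\<close> of a space of \<open>m \<times> m\<close> matrices, applied to a
  matrix \<open>v\<close>. The space is finite-dimensional, so the series
  \<open>\<Sum>k. X\<^sup>k / k!\<close> converges exactly if it does so on each \<open>v\<close>, entry by entry.
\<close>

definition exp_end :: "nat \<Rightarrow> (complex mat \<Rightarrow> complex mat) \<Rightarrow> complex mat \<Rightarrow> complex mat" where
  "exp_end m X v = mat m m (\<lambda>(a, b). \<Sum>k. ((X ^^ k) v) $$ (a, b) / fact k)"

text \<open>
  The group of Lie algebra automorphisms of \<open>sl m\<close>, with composition as product. As
  in \<^const>\<open>BijGroup\<close>, its elements are extensional functions: they are \<open>undefined\<close>
  outside \<open>sl m\<close>, so that equality of elements is equality of maps on \<open>sl m\<close>.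
\<close>

definition lie_auto :: "nat \<Rightarrow> (complex mat \<Rightarrow> complex mat) set" where
  "lie_auto m = {\<phi> \<in> Bij (sl m).
     (\<forall>x\<in>sl m. \<forall>y\<in>sl m. \<phi> (x + y) = \<phi> x + \<phi> y) \<and>
     (\<forall>c. \<forall>x\<in>sl m. \<phi> (c \<cdot>\<^sub>m x) = c \<cdot>\<^sub>m \<phi> x) \<and>
     (\<forall>x\<in>sl m. \<forall>y\<in>sl m. \<phi> (bracket x y) = bracket (\<phi> x) (\<phi> y))}"

definition Aut_sl :: "nat \<Rightarrow> (complex mat \<Rightarrow> complex mat) monoid" where
  "Aut_sl m = (BijGroup (sl m)) \<lparr>carrier := lie_auto m\<rparr>"

definition tau :: "nat \<Rightarrow> nat \<Rightarrow> complex mat \<Rightarrow> complex mat" where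
  "tau n i = restrict
     (exp_end (n + 1) (ad (chev_e n i)) \<circ>
      exp_end (n + 1) (ad (- chev_f n i)) \<circ>
      exp_end (n + 1) (ad (chev_e n i)))
     (sl (n + 1))"

definition weight_eps :: "nat \<Rightarrow> complex mat \<Rightarrow> complex" where
  "weight_eps i d = d $$ (i - 1, i - 1)"

definition simple_root :: "nat \<Rightarrow> complex mat \<Rightarrow> complex" where
  "simple_root j d = weight_eps j d - weight_eps (j + 1) d"

text \<open>The alternating product \<open>a \<otimes> b \<otimes> a \<otimes> \<dots>\<close> with \<open>k\<close> factors.\<close>

fun alt_prod :: "('a, 'b) monoid_scheme \<Rightarrow> nat \<Rightarrow> 'a \<Rightarrow> 'a \<Rightarrow> 'a" where
  "alt_prod G 0 a b = \<one>\<^bsub>G\<^esub>"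
| "alt_prod G (Suc k) a b = a \<otimes>\<^bsub>G\<^esub> alt_prod G k b a"

text \<open>Only used for distinct \<open>i\<close> and \<open>j\<close>.\<close>

definition coxeter_m :: "nat \<Rightarrow> nat \<Rightarrow> nat" where
  "coxeter_m i j = (if \<bar>int i - int j\<bar> = 1 then 3 else 2)"

end

theory Submission
  imports Defs "HOL-Combinatorics.Permutations"
begin

text \<open>
  Since \<open>e\<^sub>i\<close> and \<open>f\<^sub>i\<close> square to zero, \<open>exp (ad x) v = (1 + x) v (1 - x)\<close> for \<open>x = e\<^sub>i\<close>
  and \<open>x = - f\<^sub>i\<close>. Hence \<open>\<tau>\<^sub>i\<close> is conjugation by \<open>s\<^sub>i = (1 + e\<^sub>i) (1 - f\<^sub>i) (1 + e\<^sub>i)\<close>, which is the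
  signed permutation matrix that carries \<open>(0, 1; -1, 0)\<close> in rows and columns \<open>i, i + 1\<close>. The
  relations already hold between the signed permutation matrices \<open>s\<^sub>i\<close>, where they amount to
  identities between permutations and signs.
\<close>

section \<open>The automorphism group\<close>

lemma (in monoid) nat_pow_2: "x \<in> carrier G \<Longrightarrow> x [^] (2::nat) = x \<otimes> x"
  by (simp add: numeral_2_eq_2)

lemma (in monoid) nat_pow_4: "x \<in> carrier G \<Longrightarrow> x [^] (4::nat) = x [^] (2::nat) \<otimes> x [^] (2::nat)"
  using nat_pow_mult[of x 2 2] by simp

lemma (in monoid) alt_prod_2:
  "x \<in> carrier G \<Longrightarrow> y \<in> carrier G \<Longrightarrow> alt_prod G 2 x y = x \<otimes> y"
  by (simp add: numeral_2_eq_2)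

lemma (in monoid) alt_prod_3:
  "x \<in> carrier G \<Longrightarrow> y \<in> carrier G \<Longrightarrow> alt_prod G 3 x y = x \<otimes> (y \<otimes> x)"
  by (simp add: numeral_3_eq_3)

section \<open>Closure of \<open>sl m\<close> under the Lie algebra operations, and its automorphism
  group\<close>

lemma sl_carrier: "x \<in> sl m \<Longrightarrow> x \<in> carrier_mat m m"
  by (simp add: sl_def)

lemma mat_trace_mult_commute:
  assumes "x \<in> carrier_mat m m" "y \<in> carrier_mat m m"
  shows "mat_trace (x * y) = mat_trace (y * x)"
proof -
  have "mat_trace (x * y) = (\<Sum>k<m. \<Sum>l<m. x $$ (k, l) * y $$ (l, k))"
    using assms by (simp add: mat_trace_def scalar_prod_def atLeast0LessThan)
  also have "\<dots> = (\<Sum>l<m. \<Sum>k<m. x $$ (k, l) * y $$ (l, k))"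
    by (rule sum.swap)
  also have "\<dots> = mat_trace (y * x)"
    using assms by (simp add: mat_trace_def scalar_prod_def atLeast0LessThan mult.commute)
  finally show ?thesis .
qed

lemma sl_add: "x \<in> sl m \<Longrightarrow> y \<in> sl m \<Longrightarrow> x + y \<in> sl m"
  by (auto simp: sl_def mat_trace_def sum.distrib)

lemma sl_smult: "x \<in> sl m \<Longrightarrow> c \<cdot>\<^sub>m x \<in> sl m"
  by (auto simp: sl_def mat_trace_def simp flip: sum_distrib_left)

lemma sl_bracket:
  assumes "x \<in> sl m" "y \<in> sl m"
  shows "bracket x y \<in> sl m"
proof -
  have c: "x \<in> carrier_mat m m" "y \<in> carrier_mat m m"
    using assms by (auto simp: sl_def)
  then have "mat_trace (bracket x y) = mat_trace (x * y) - mat_trace (y * x)"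
    by (simp add: bracket_def mat_trace_def sum_subtractf)
  then show ?thesis
    using c mat_trace_mult_commute[OF c] by (auto simp: sl_def bracket_def)
qed

text \<open>\<open>Aut_sl\<close> only shrinks the carrier of \<open>BijGroup\<close>, so its group
  laws, and the agreement of its inverses with inverse maps, rest on this subgroup property.\<close>

lemma lie_auto_subgroup: "subgroup (lie_auto m) (BijGroup (sl m))"
proof -
  interpret B: group "BijGroup (sl m)"
    by (rule group_BijGroup)
  show ?thesis
  proof (rule B.subgroupI)
    show "lie_auto m \<subseteq> carrier (BijGroup (sl m))"
      by (auto simp: lie_auto_def BijGroup_def)
    have "(\<lambda>x\<in>sl m. x) \<in> lie_auto m"
      by (auto simp: lie_auto_def id_Bij sl_add sl_smult sl_bracket)
    then show "lie_auto m \<noteq> {}"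
      by blast
  next
    fix f assume f: "f \<in> lie_auto m"
    then have fB: "f \<in> Bij (sl m)"
      by (simp add: lie_auto_def)
    then have bij: "bij_betw f (sl m) (sl m)"
      by (simp add: Bij_def)
    define g where "g = inv_into (sl m) f"
    have g: "g x \<in> sl m" "f (g x) = x" if "x \<in> sl m" for x
      using that bij unfolding g_def
      by (metis bij_betw_imp_surj_on inv_into_into, metis bij_betw_inv_into_right)
    \<comment> \<open>Injectivity of \<open>f\<close>: to prove an equation for the inverse map
      \<open>g\<close> it suffices to apply \<open>f\<close> to the expected value. Additivity,
      homogeneity and compatibility with the bracket pass from \<open>f\<close> to \<open>g\<close>
      in this way.\<close>
    have gI: "g x = y" if "y \<in> sl m" "f y = x" for x y
      using that bij unfolding g_def by (metis bij_betw_inv_into_left)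
    have "(\<lambda>x\<in>sl m. g x) \<in> lie_auto m"
      using restrict_inv_into_Bij[OF fB] f g
      by (auto simp: lie_auto_def sl_add sl_smult sl_bracket simp flip: g_def intro!: gI)
    then show "inv\<^bsub>BijGroup (sl m)\<^esub> f \<in> lie_auto m"
      by (simp add: inv_BijGroup[OF fB] g_def)
  next
    fix f g assume fg: "f \<in> lie_auto m" "g \<in> lie_auto m"
    then have B: "f \<in> Bij (sl m)" "g \<in> Bij (sl m)"
      by (auto simp: lie_auto_def)
    then have "g x \<in> sl m" if "x \<in> sl m" for x
      using that Bij_imp_funcset by blast
    then have "compose (sl m) f g \<in> lie_auto m"
      using fg compose_Bij[OF B]
      by (auto simp: lie_auto_def compose_eq sl_add sl_smult sl_bracket)
    then show "f \<otimes>\<^bsub>BijGroup (sl m)\<^esub> g \<in> lie_auto m"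
      using B by (simp add: BijGroup_def)
  qed
qed

lemma group_Aut_sl: "group (Aut_sl m)"
  unfolding Aut_sl_def
  by (rule subgroup.subgroup_is_group[OF lie_auto_subgroup group_BijGroup])

lemma monoid_Aut_sl: "monoid (Aut_sl m)"
  by (rule group.is_monoid[OF group_Aut_sl])

lemma carrier_Aut_sl [simp]: "carrier (Aut_sl m) = lie_auto m"
  by (simp add: Aut_sl_def)

section \<open>Conjugation by signed permutation matrices\<close>

text \<open>This is v -> s v s^(-1) for the monomial matrix s with entry \<open>c a\<close> in row
  \<open>a\<close> and column \<open>p a\<close>. When the \<open>c a\<close> are signs, the inverse
  of s is its transpose, so s itself never has to be formed. Restriction to \<open>sl m\<close>
  gives the extensional form that \<open>Bij\<close> demands.\<close>

definition sconj :: "nat \<Rightarrow> (nat \<Rightarrow> complex) \<Rightarrow> (nat \<Rightarrow> nat) \<Rightarrow> complex mat \<Rightarrow> complex mat" where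
  "sconj m c p = (\<lambda>v\<in>sl m. mat m m (\<lambda>(a, b). c a * c b * v $$ (p a, p b)))"

text \<open>The sign condition ranges over all natural numbers, so it passes to products and
  reindexings of \<open>c\<close> without range conditions.\<close>

definition signed_perm :: "nat \<Rightarrow> (nat \<Rightarrow> complex) \<Rightarrow> (nat \<Rightarrow> nat) \<Rightarrow> bool" where
  "signed_perm m c p \<longleftrightarrow> (\<forall>a. c a * c a = 1) \<and> p permutes {..<m}"

lemma signed_perm_lt: "signed_perm m c p \<Longrightarrow> a < m \<Longrightarrow> p a < m"
  unfolding signed_perm_def by (metis lessThan_iff permutes_in_image)

lemma sconj_in_sl:
  assumes s: "signed_perm m c p" and v: "v \<in> sl m"
  shows "sconj m c p v \<in> sl m"
proof -
  have "(\<Sum>k<m. v $$ (p k, p k)) = (\<Sum>k<m. v $$ (k, k))"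
    using s sum.permute[of p "{..<m}" "\<lambda>k. v $$ (k, k)"] by (simp add: signed_perm_def comp_def)
  then show ?thesis
    using s v by (auto simp: sconj_def sl_def mat_trace_def signed_perm_def)
qed

text \<open>Row \<open>a\<close> of the product of the two monomial matrices is reached through row
  \<open>p a\<close> of the second one. Hence the permutations compose in the order opposite to the
  maps, and the second sign is read at \<open>p a\<close>.\<close>

lemma sconj_sconj:
  assumes "signed_perm m c p" "signed_perm m d q" "v \<in> sl m"
  shows "sconj m c p (sconj m d q v) = sconj m (\<lambda>a. c a * d (p a)) (q \<circ> p) v"
proof -
  have "sconj m d q v \<in> sl m"
    using assms sconj_in_sl by blast
  then show ?thesis
    using assms(3) signed_perm_lt[OF assms(1)]
    by (auto simp: sconj_def intro!: eq_matI)
qed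

text \<open>Every relation between the generators is reduced by this rule to one identity of signs
  and one of permutations, checked index by index.\<close>

lemma sconj_cong:
  assumes "\<And>a. a < m \<Longrightarrow> c a = d a" "\<And>a. a < m \<Longrightarrow> p a = q a"
  shows "sconj m c p = sconj m d q"
  unfolding sconj_def using assms by (auto simp: fun_eq_iff restrict_def intro!: eq_matI)

lemma sconj_id: "sconj m (\<lambda>_. 1) id = (\<lambda>v\<in>sl m. v)"
  by (auto simp: sconj_def fun_eq_iff restrict_def sl_def intro!: eq_matI)

lemma signed_perm_comp:
  assumes "signed_perm m c p" "signed_perm m d q"
  shows "signed_perm m (\<lambda>a. c a * d (p a)) (q \<circ> p)"
proof -
  have c: "c a * c a = 1" "d a * d a = 1" for a
    using assms by (auto simp: signed_perm_def)
  have "c a * d (p a) * (c a * d (p a)) = (c a * c a) * (d (p a) * d (p a))" for a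
    by (simp only: mult_ac)
  then have "c a * d (p a) * (c a * d (p a)) = 1" for a
    by (simp only: c mult_1)
  then show ?thesis
    using assms by (simp add: signed_perm_def permutes_compose)
qed

section \<open>Signed conjugations as elements of the automorphism group\<close>

lemma sconj_Bij:
  assumes s: "signed_perm m c p"
  shows "sconj m c p \<in> Bij (sl m)"
proof -
  \<comment> \<open>The transposed monomial matrix has its entry of row \<open>a\<close> in column
    \<open>?q a\<close>, with the sign \<open>c (?q a)\<close>. In either composition the two signs
    are equal and multiply to 1.\<close>
  let ?q = "inv_into UNIV p"
  let ?d = "\<lambda>a. c (?q a)"
  have p: "p permutes {..<m}" and c: "\<And>a. c a * c a = 1"
    using s by (auto simp: signed_perm_def)
  have s': "signed_perm m ?d ?q"
    using p c by (auto simp: signed_perm_def permutes_inv)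
  have 1: "sconj m ?d ?q (sconj m c p v) = v" if "v \<in> sl m" for v
    using that c sconj_id[of m]
    by (simp add: sconj_sconj[OF s' s] permutes_inv_o[OF p])
  have 2: "sconj m c p (sconj m ?d ?q v) = v" if "v \<in> sl m" for v
    using that c sconj_id[of m]
    by (simp add: sconj_sconj[OF s s'] permutes_inv_o[OF p] permutes_inverses[OF p])
  have "bij_betw (sconj m c p) (sl m) (sl m)"
    using 1 2 sconj_in_sl[OF s] sconj_in_sl[OF s']
    by (intro bij_betw_byWitness[where f' = "sconj m ?d ?q"]) auto
  then show ?thesis
    by (simp add: Bij_def sconj_def)
qed

text \<open>Signed conjugation already respects the associative product: the inner index contributes
  the same sign twice, which cancels, and summing over \<open>p k\<close> is summing over
  \<open>k\<close>.\<close>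

lemma sconj_bracket:
  assumes s: "signed_perm m c p" and x: "x \<in> sl m" and y: "y \<in> sl m"
  shows "sconj m c p (bracket x y) = bracket (sconj m c p x) (sconj m c p y)"
proof (rule eq_matI)
  note lt = signed_perm_lt[OF s]
  have p: "p permutes {..<m}" and c: "\<And>a. c a * c a = 1"
    using s by (auto simp: signed_perm_def)
  have X: "x \<in> carrier_mat m m" "y \<in> carrier_mat m m"
    and X': "sconj m c p x \<in> carrier_mat m m" "sconj m c p y \<in> carrier_mat m m"
    using x y sconj_in_sl[OF s] sl_carrier by blast+
  have prod: "(sconj m c p u * sconj m c p w) $$ (a, b) = c a * c b * (u * w) $$ (p a, p b)"
    if "u \<in> sl m" "w \<in> sl m" "a < m" "b < m" for u w a b
  proof -
    have C: "u \<in> carrier_mat m m" "w \<in> carrier_mat m m"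
      using that sl_carrier by blast+
    have "(sconj m c p u * sconj m c p w) $$ (a, b) =
        (\<Sum>k<m. (c a * c k * u $$ (p a, p k)) * (c k * c b * w $$ (p k, p b)))"
      using that by (simp add: sconj_def scalar_prod_def atLeast0LessThan)
    also have "\<dots> = (\<Sum>k<m. (c k * c k) * (c a * c b * (u $$ (p a, p k) * w $$ (p k, p b))))"
      by (intro sum.cong) (simp_all only: mult_ac)
    also have "\<dots> = c a * c b * (\<Sum>k<m. u $$ (p a, p k) * w $$ (p k, p b))"
      by (simp add: c sum_distrib_left)
    also have "(\<Sum>k<m. u $$ (p a, p k) * w $$ (p k, p b)) = (\<Sum>k<m. u $$ (p a, k) * w $$ (k, p b))"
      using sum.permute[OF p, of "\<lambda>k. u $$ (p a, k) * w $$ (k, p b)"] by (simp add: comp_def)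
    also have "\<dots> = (u * w) $$ (p a, p b)"
      using C that lt by (simp add: scalar_prod_def atLeast0LessThan)
    finally show ?thesis .
  qed
  show "dim_row (sconj m c p (bracket x y)) = dim_row (bracket (sconj m c p x) (sconj m c p y))"
    "dim_col (sconj m c p (bracket x y)) = dim_col (bracket (sconj m c p x) (sconj m c p y))"
    using X X' sl_bracket[OF x y] by (auto simp: sconj_def bracket_def)
  fix a b
  assume "a < dim_row (bracket (sconj m c p x) (sconj m c p y))"
    "b < dim_col (bracket (sconj m c p x) (sconj m c p y))"
  then have ab: "a < m" "b < m"
    using X' by (auto simp: bracket_def)
  have "sconj m c p (bracket x y) $$ (a, b) = c a * c b * bracket x y $$ (p a, p b)"
    using ab sl_bracket[OF x y] by (simp add: sconj_def)
  also have "\<dots> = c a * c b * (x * y) $$ (p a, p b) - c a * c b * (y * x) $$ (p a, p b)"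
    using X ab lt by (simp add: bracket_def right_diff_distrib del: index_mult_mat(1))
  also have "\<dots> = bracket (sconj m c p x) (sconj m c p y) $$ (a, b)"
    \<comment> \<open>Entries of products must stay unexpanded here, since \<open>prod\<close>
      rewrites them as a whole.\<close>
    using X' ab by (simp add: bracket_def prod[OF x y ab] prod[OF y x ab] del: index_mult_mat(1))
  finally show "sconj m c p (bracket x y) $$ (a, b) =
      bracket (sconj m c p x) (sconj m c p y) $$ (a, b)" .
qed

lemma sconj_lie_auto:
  assumes s: "signed_perm m c p"
  shows "sconj m c p \<in> lie_auto m"
proof -
  note lt = signed_perm_lt[OF s]
  have "sconj m c p (x + y) = sconj m c p x + sconj m c p y" if "x \<in> sl m" "y \<in> sl m" for x y
    using that sl_add[OF that] sl_carrier[OF that(1)] sl_carrier[OF that(2)] lt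
    by (auto simp: sconj_def algebra_simps intro!: eq_matI)
  moreover have "sconj m c p (k \<cdot>\<^sub>m x) = k \<cdot>\<^sub>m sconj m c p x" if "x \<in> sl m" for k x
    using that sl_smult[OF that] sl_carrier[OF that] lt
    by (auto simp: sconj_def intro!: eq_matI)
  ultimately show ?thesis
    using sconj_Bij[OF s] sconj_bracket[OF s] by (auto simp: lie_auto_def)
qed

lemma sconj_mult:
  assumes "signed_perm m c p" "signed_perm m d q"
  shows "sconj m c p \<otimes>\<^bsub>Aut_sl m\<^esub> sconj m d q = sconj m (\<lambda>a. c a * d (p a)) (q \<circ> p)"
proof -
  have "compose (sl m) (sconj m c p) (sconj m d q) = sconj m (\<lambda>a. c a * d (p a)) (q \<circ> p)"
  proof
    fix v
    show "compose (sl m) (sconj m c p) (sconj m d q) v = sconj m (\<lambda>a. c a * d (p a)) (q \<circ> p) v"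
      using sconj_sconj[OF assms, of v]
      by (cases "v \<in> sl m") (auto simp: compose_def sconj_def)
  qed
  then show ?thesis
    using sconj_Bij assms by (simp add: Aut_sl_def BijGroup_def)
qed

lemma sconj_one: "\<one>\<^bsub>Aut_sl m\<^esub> = sconj m (\<lambda>_. 1) id"
  by (simp add: sconj_id Aut_sl_def BijGroup_def)

section \<open>The exponentials\<close>

lemma index_matrix_unit_mult:
  assumes "v \<in> carrier_mat m m" "1 \<le> i" "i \<le> m" "1 \<le> j" "j \<le> m" "a < m" "b < m"
  shows "(matrix_unit m i j * v) $$ (a, b) = (if a + 1 = i then v $$ (j - 1, b) else 0)"
    and "(v * matrix_unit m i j) $$ (a, b) = (if b + 1 = j then v $$ (a, i - 1) else 0)"
proof -
  have "(matrix_unit m i j * v) $$ (a, b) =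
      (\<Sum>k<m. (if a + 1 = i \<and> k + 1 = j then 1 else 0) * v $$ (k, b))"
    using assms by (simp add: matrix_unit_def scalar_prod_def atLeast0LessThan)
  \<comment> \<open>As \<open>j\<close> is at least 1, the shifted condition
    \<open>k + 1 = j\<close> becomes \<open>k = j - 1\<close>, the shape that
    \<open>sum.delta\<close> collapses.\<close>
  also have "\<dots> = (\<Sum>k<m. if k = j - 1 then (if a + 1 = i then v $$ (k, b) else 0) else 0)"
    using assms by (intro sum.cong) auto
  finally show "(matrix_unit m i j * v) $$ (a, b) = (if a + 1 = i then v $$ (j - 1, b) else 0)"
    using assms by (auto simp: sum.delta)
  have "(v * matrix_unit m i j) $$ (a, b) =
      (\<Sum>k<m. v $$ (a, k) * (if k + 1 = i \<and> b + 1 = j then 1 else 0))"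
    using assms by (simp add: matrix_unit_def scalar_prod_def atLeast0LessThan)
  also have "\<dots> = (\<Sum>k<m. if k = i - 1 then (if b + 1 = j then v $$ (a, k) else 0) else 0)"
    using assms by (intro sum.cong) auto
  finally show "(v * matrix_unit m i j) $$ (a, b) = (if b + 1 = j then v $$ (a, i - 1) else 0)"
    using assms by (auto simp: sum.delta)
qed

lemma exp_end_carrier [simp]: "exp_end m X v \<in> carrier_mat m m"
  by (simp add: exp_end_def)

text \<open>For x = t E_ij with distinct i and j, x squares to zero, so the third power of ad x
  vanishes and the series is v + (xv - vx) - xvx. The last term is a single entry because E_ij v
  E_ij = v_ji E_ij. The scalar \<open>t\<close> covers both e_i and -f_i.\<close>

lemma exp_end_matrix_unit:
  assumes v: "v \<in> carrier_mat m m"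
    and ij: "1 \<le> i" "i \<le> m" "1 \<le> j" "j \<le> m" "i \<noteq> j"
    and ab: "a < m" "b < m"
  shows "exp_end m (ad (t \<cdot>\<^sub>m matrix_unit m i j)) v $$ (a, b) =
    v $$ (a, b) + (if a + 1 = i then t * v $$ (j - 1, b) else 0)
      - (if b + 1 = j then t * v $$ (a, i - 1) else 0)
      - (if a + 1 = i \<and> b + 1 = j then t\<^sup>2 * v $$ (j - 1, i - 1) else 0)"
proof -
  let ?D = "ad (t \<cdot>\<^sub>m matrix_unit m i j)"
  have E: "matrix_unit m i j \<in> carrier_mat m m"
    by (simp add: matrix_unit_def)
  have D: "?D w \<in> carrier_mat m m" if "w \<in> carrier_mat m m" for w
    using that E by (auto simp: bracket_def)
  have Dx: "?D w $$ (a, b) = (if a + 1 = i then t * w $$ (j - 1, b) else 0)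
      - (if b + 1 = j then t * w $$ (a, i - 1) else 0)"
    if w: "w \<in> carrier_mat m m" and "a < m" "b < m" for w a b
  proof -
    have "?D w = t \<cdot>\<^sub>m (matrix_unit m i j * w) - t \<cdot>\<^sub>m (w * matrix_unit m i j)"
      using w E by (simp add: bracket_def mult_smult_assoc_mat[OF E w] mult_smult_distrib[OF w E])
    then show ?thesis
      using that w E by (simp add: index_matrix_unit_mult[OF w ij(1-4)] del: index_mult_mat(1))
  qed
  define w1 where "w1 = ?D v"
  define w2 where "w2 = ?D w1"
  define w3 where "w3 = ?D w2"
  have C: "w1 \<in> carrier_mat m m" "w2 \<in> carrier_mat m m" "w3 \<in> carrier_mat m m"
    by (simp_all add: w1_def w2_def w3_def D v)
  have j1: "Suc (j - Suc 0) = j" "Suc (i - Suc 0) = i" "j - Suc 0 < m" "i - Suc 0 < m"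
    using ij by auto
  have 1: "w1 $$ (a, b) = (if a + 1 = i then t * v $$ (j - 1, b) else 0)
      - (if b + 1 = j then t * v $$ (a, i - 1) else 0)" if "a < m" "b < m" for a b
    using that by (simp add: w1_def Dx[OF v])
  \<comment> \<open>The second power of ad x sends v to -2xvx, as the terms with the square of x
    vanish. Division by 2! later removes the factor 2.\<close>
  have 2: "w2 $$ (a, b) = (if a + 1 = i \<and> b + 1 = j then - 2 * t\<^sup>2 * v $$ (j - 1, i - 1) else 0)"
    if "a < m" "b < m" for a b
    using that ij j1 by (auto simp: w2_def Dx[OF C(1)] 1 power2_eq_square)
  have "w3 = 0\<^sub>m m m"
    using C(3) ij j1 by (intro eq_matI) (auto simp: w3_def Dx[OF C(2)] 2)
  moreover have "?D (0\<^sub>m m m) = 0\<^sub>m m m"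
    using D[of "0\<^sub>m m m"] j1 by (intro eq_matI) (auto simp: Dx)
  then have "(?D ^^ k) (0\<^sub>m m m) = 0\<^sub>m m m" for k
    by (induction k) auto
  moreover have "(?D ^^ 3) v = w3"
    by (simp add: numeral_3_eq_3 w1_def w2_def w3_def)
  ultimately have Dk: "(?D ^^ (k + 3)) v = 0\<^sub>m m m" for k
    by (simp only: funpow_add comp_def)
  have "exp_end m ?D v $$ (a, b) = (\<Sum>k. (?D ^^ k) v $$ (a, b) / fact k)"
    using ab by (simp add: exp_end_def)
  \<comment> \<open>Only the terms of index 0, 1 and 2 survive, so the infinite sum is a finite
    one.\<close>
  also have "\<dots> = (\<Sum>k<3. (?D ^^ k) v $$ (a, b) / fact k)"
  proof (rule suminf_finite)
    fix k :: nat assume "k \<notin> {..<3}"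
    then obtain l where "k = l + 3"
      by (metis add.commute le_Suc_ex lessThan_iff not_less)
    then show "(?D ^^ k) v $$ (a, b) / fact k = 0"
      using ab Dk by simp
  qed simp
  also have "\<dots> = v $$ (a, b) + w1 $$ (a, b) + w2 $$ (a, b) / 2"
    by (simp add: numeral_3_eq_3 lessThan_Suc w2_def w1_def)
  finally show ?thesis
    using ab by (auto simp: 1 2)
qed

section \<open>The relations\<close>

text \<open>Counted from 0, the block (0, 1; -1, 0) of s_i occupies rows \<open>i - 1\<close> and
  \<open>i\<close>, so its entry -1 lies in row \<open>i\<close>.\<close>

definition tau_sgn :: "nat \<Rightarrow> nat \<Rightarrow> complex" where
  "tau_sgn i a = (if a = i then - 1 else 1)"

definition tau_perm :: "nat \<Rightarrow> nat \<Rightarrow> nat" where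
  "tau_perm i = Transposition.transpose (i - 1) i"

text \<open>Stated for \<open>Suc k\<close> to avoid truncated subtraction. The later proofs write
  each index as a successor so that these rules evaluate the permutations after a case
  split.\<close>

lemma tau_perm_simps [simp]:
  "tau_perm (Suc k) k = Suc k"
  "tau_perm (Suc k) (Suc k) = k"
  "a \<noteq> k \<Longrightarrow> a \<noteq> Suc k \<Longrightarrow> tau_perm (Suc k) a = a"
  by (simp_all add: tau_perm_def)

lemma signed_perm_tau: "i \<in> {1..n} \<Longrightarrow> signed_perm (n + 1) (tau_sgn i) (tau_perm i)"
  by (auto simp: signed_perm_def tau_sgn_def tau_perm_def intro!: permutes_swap_id)

lemma tau_eq_sconj:
  assumes i: "i \<in> {1..n}"
  shows "tau n i = sconj (n + 1) (tau_sgn i) (tau_perm i)"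
proof
  fix v
  show "tau n i v = sconj (n + 1) (tau_sgn i) (tau_perm i) v"
  proof (cases "v \<in> sl (n + 1)")
    case False
    then show ?thesis
      by (simp add: tau_def sconj_def)
  next
    case True
    let ?m = "n + 1"
    have v: "v \<in> carrier_mat ?m ?m"
      using True by (rule sl_carrier)
    \<comment> \<open>Both generators are put in the form of \<open>exp_end_matrix_unit\<close>,
      with \<open>t\<close> equal to 1 and -1.\<close>
    have e: "chev_e n i = 1 \<cdot>\<^sub>m matrix_unit ?m i (i + 1)"
      by (auto simp: chev_e_def matrix_unit_def)
    have f: "- chev_f n i = (- 1) \<cdot>\<^sub>m matrix_unit ?m (i + 1) i"
      by (auto simp: chev_f_def matrix_unit_def)
    define u where "u = exp_end ?m (ad (chev_e n i)) v"
    define w where "w = exp_end ?m (ad (- chev_f n i)) u"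
    define z where "z = exp_end ?m (ad (chev_e n i)) w"
    have C: "u \<in> carrier_mat ?m ?m" "w \<in> carrier_mat ?m ?m" "z \<in> carrier_mat ?m ?m"
      by (simp_all add: u_def w_def z_def)
    \<comment> \<open>Rows \<open>k\<close> and \<open>Suc k\<close>, counted from 0, are the rows i
      and i + 1 of the usual numbering.\<close>
    obtain k where k: "i = Suc k" "k < n"
      using i by (cases i) auto
    have u: "u $$ (a, b) = v $$ (a, b) + (if a = k then v $$ (Suc k, b) else 0)
      - (if b = Suc k then v $$ (a, k) else 0)
      - (if a = k \<and> b = Suc k then v $$ (Suc k, k) else 0)" if "a < ?m" "b < ?m" for a b
      unfolding u_def e using that k by (subst exp_end_matrix_unit[OF v]) auto
    have w: "w $$ (a, b) = u $$ (a, b) - (if a = Suc k then u $$ (k, b) else 0)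
      + (if b = k then u $$ (a, Suc k) else 0)
      - (if a = Suc k \<and> b = k then u $$ (k, Suc k) else 0)" if "a < ?m" "b < ?m" for a b
      unfolding w_def f using that k by (subst exp_end_matrix_unit[OF C(1)]) auto
    have z: "z $$ (a, b) = w $$ (a, b) + (if a = k then w $$ (Suc k, b) else 0)
      - (if b = Suc k then w $$ (a, k) else 0)
      - (if a = k \<and> b = Suc k then w $$ (Suc k, k) else 0)" if "a < ?m" "b < ?m" for a b
      unfolding z_def e using that k by (subst exp_end_matrix_unit[OF C(2)]) auto
    have "z = sconj ?m (tau_sgn i) (tau_perm i) v"
    proof (rule eq_matI)
      fix a b
      assume "a < dim_row (sconj ?m (tau_sgn i) (tau_perm i) v)"
        "b < dim_col (sconj ?m (tau_sgn i) (tau_perm i) v)"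
      then have ab: "a < ?m" "b < ?m"
        using True by (auto simp: sconj_def)
      have kl: "k < ?m" "Suc k < ?m"
        using k by auto
      consider "a = k" | "a = Suc k" | "a \<noteq> k" "a \<noteq> Suc k" by blast
      then show "z $$ (a, b) = sconj ?m (tau_sgn i) (tau_perm i) v $$ (a, b)"
        using ab True kl
        by cases (auto simp: sconj_def z w u tau_sgn_def tau_perm_def k(1) Transposition.transpose_def)
    qed (use C True in \<open>auto simp: sconj_def\<close>)
    then show ?thesis
      using True by (simp add: tau_def u_def w_def z_def)
  qed
qed

text \<open>These are the off-diagonal entries of the Cartan matrix of type A_n.\<close>

lemma simple_root_chev_h:
  assumes "i \<in> {1..n}" "j \<in> {1..n}" "i \<noteq> j"
  shows "simple_root j (chev_h n i) = (if \<bar>int i - int j\<bar> = 1 then - 1 else 0)"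
  using assms by (auto simp: simple_root_def weight_eps_def chev_h_def matrix_unit_def)

lemma tau_in_carrier: "i \<in> {1..n} \<Longrightarrow> tau n i \<in> carrier (Aut_sl (n + 1))"
  by (simp only: tau_eq_sconj carrier_Aut_sl sconj_lie_auto signed_perm_tau)

section \<open>Squares and fourth powers\<close>

lemma signed_perm_tau_sq:
  "i \<in> {1..n} \<Longrightarrow> signed_perm (n + 1) (\<lambda>a. if a + 1 = i \<or> a = i then - 1 else 1) id"
  by (auto simp: signed_perm_def permutes_id)

text \<open>The block (0, 1; -1, 0) squares to minus the identity, so s_i^2 is diagonal with -1
  exactly in rows \<open>i - 1\<close> and \<open>i\<close>. The condition \<open>a + 1 = i\<close>
  expresses the first of them. Commuting squares and fourth power 1 follow, since these matrices are
  diagonal with entries 1 and -1.\<close>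

lemma tau_sq:
  assumes "i \<in> {1..n}"
  shows "tau n i [^]\<^bsub>Aut_sl (n + 1)\<^esub> (2::nat) =
    sconj (n + 1) (\<lambda>a. if a + 1 = i \<or> a = i then - 1 else 1) id"
proof -
  have "tau n i [^]\<^bsub>Aut_sl (n + 1)\<^esub> (2::nat) = tau n i \<otimes>\<^bsub>Aut_sl (n + 1)\<^esub> tau n i"
    by (rule monoid.nat_pow_2[OF monoid_Aut_sl tau_in_carrier[OF assms]])
  also have "\<dots> = sconj (n + 1) (\<lambda>a. if a + 1 = i \<or> a = i then - 1 else 1) id"
    unfolding tau_eq_sconj[OF assms]
      sconj_mult[OF signed_perm_tau[OF assms] signed_perm_tau[OF assms]]
  proof (rule sconj_cong)
    obtain k where k: "i = Suc k"
      using assms by (cases i) auto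
    fix a
    show "tau_sgn i a * tau_sgn i (tau_perm i a) = (if a + 1 = i \<or> a = i then - 1 else 1)"
      "(tau_perm i \<circ> tau_perm i) a = id a"
      unfolding k by (cases "a = k"; cases "a = Suc k"; simp add: tau_sgn_def)+
  qed
  finally show ?thesis .
qed

lemma tau_sq_commute:
  assumes "i \<in> {1..n}" "j \<in> {1..n}"
  shows "tau n i [^]\<^bsub>Aut_sl (n + 1)\<^esub> (2::nat) \<otimes>\<^bsub>Aut_sl (n + 1)\<^esub> tau n j [^]\<^bsub>Aut_sl (n + 1)\<^esub> (2::nat)
    = tau n j [^]\<^bsub>Aut_sl (n + 1)\<^esub> (2::nat) \<otimes>\<^bsub>Aut_sl (n + 1)\<^esub> tau n i [^]\<^bsub>Aut_sl (n + 1)\<^esub> (2::nat)"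
  unfolding tau_sq[OF assms(1)] tau_sq[OF assms(2)]
    sconj_mult[OF signed_perm_tau_sq[OF assms(1)] signed_perm_tau_sq[OF assms(2)]]
    sconj_mult[OF signed_perm_tau_sq[OF assms(2)] signed_perm_tau_sq[OF assms(1)]]
  by (rule sconj_cong) auto

lemma tau_pow_4:
  assumes "i \<in> {1..n}"
  shows "tau n i [^]\<^bsub>Aut_sl (n + 1)\<^esub> (4::nat) = \<one>\<^bsub>Aut_sl (n + 1)\<^esub>"
proof -
  have "tau n i [^]\<^bsub>Aut_sl (n + 1)\<^esub> (4::nat) =
      tau n i [^]\<^bsub>Aut_sl (n + 1)\<^esub> (2::nat) \<otimes>\<^bsub>Aut_sl (n + 1)\<^esub> tau n i [^]\<^bsub>Aut_sl (n + 1)\<^esub> (2::nat)"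
    by (rule monoid.nat_pow_4[OF monoid_Aut_sl tau_in_carrier[OF assms]])
  also have "\<dots> = \<one>\<^bsub>Aut_sl (n + 1)\<^esub>"
    unfolding tau_sq[OF assms] sconj_one
      sconj_mult[OF signed_perm_tau_sq[OF assms] signed_perm_tau_sq[OF assms]]
    by (rule sconj_cong) auto
  finally show ?thesis .
qed

section \<open>Braid relations and conjugation of squares\<close>

lemma tau_braid_adjacent:
  assumes i: "i \<in> {1..n}" and j: "Suc i \<in> {1..n}"
  shows "tau n i \<otimes>\<^bsub>Aut_sl (n + 1)\<^esub> (tau n (Suc i) \<otimes>\<^bsub>Aut_sl (n + 1)\<^esub> tau n i) = tau n (Suc i) \<otimes>\<^bsub>Aut_sl (n + 1)\<^esub> (tau n i \<otimes>\<^bsub>Aut_sl (n + 1)\<^esub> tau n (Suc i))"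
proof -
  obtain k where k: "i = Suc k"
    using i by (cases i) auto
  note s = signed_perm_tau[OF i] signed_perm_tau[OF j]
  show ?thesis
    unfolding tau_eq_sconj[OF i] tau_eq_sconj[OF j] sconj_mult[OF s(1) s(2)] sconj_mult[OF s(2) s(1)]
      sconj_mult[OF s(1) signed_perm_comp[OF s(2) s(1)]]
      sconj_mult[OF s(2) signed_perm_comp[OF s(1) s(2)]]
    unfolding k
  \<comment> \<open>Both permutations exchange \<open>k\<close> and \<open>k + 2\<close> and fix
    everything else; the signs can differ from 1 only at \<open>k\<close>, \<open>k + 1\<close> and
    \<open>k + 2\<close>, so three case distinctions decide both identities.\<close>
  proof (rule sconj_cong)
    fix a
    show "tau_sgn (Suc k) a * (tau_sgn (Suc (Suc k)) (tau_perm (Suc k) a) *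
          tau_sgn (Suc k) (tau_perm (Suc (Suc k)) (tau_perm (Suc k) a))) =
        tau_sgn (Suc (Suc k)) a * (tau_sgn (Suc k) (tau_perm (Suc (Suc k)) a) *
          tau_sgn (Suc (Suc k)) (tau_perm (Suc k) (tau_perm (Suc (Suc k)) a)))"
      "(tau_perm (Suc k) \<circ> tau_perm (Suc (Suc k)) \<circ> tau_perm (Suc k)) a =
        (tau_perm (Suc (Suc k)) \<circ> tau_perm (Suc k) \<circ> tau_perm (Suc (Suc k))) a"
      by (cases "a = k"; cases "a = Suc k"; cases "a = Suc (Suc k)"; simp add: tau_sgn_def)+
  qed
qed

text \<open>The nontrivial blocks of s_i and s_j occupy disjoint pairs of rows.\<close>

lemma tau_commute:
  assumes i: "i \<in> {1..n}" and j: "j \<in> {1..n}" and ij: "i \<noteq> j" "j \<noteq> Suc i" "i \<noteq> Suc j"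
  shows "tau n i \<otimes>\<^bsub>Aut_sl (n + 1)\<^esub> tau n j = tau n j \<otimes>\<^bsub>Aut_sl (n + 1)\<^esub> tau n i"
proof -
  obtain k l where kl: "i = Suc k" "j = Suc l"
    using i j by (cases i; cases j) auto
  then have kl': "k \<noteq> Suc l" "l \<noteq> Suc k" "k \<noteq> l"
    using ij by auto
  note s = signed_perm_tau[OF i] signed_perm_tau[OF j]
  show ?thesis
    unfolding tau_eq_sconj[OF i] tau_eq_sconj[OF j] sconj_mult[OF s(1) s(2)] sconj_mult[OF s(2) s(1)]
  proof (rule sconj_cong)
    fix a
    show "tau_sgn i a * tau_sgn j (tau_perm i a) = tau_sgn j a * tau_sgn i (tau_perm j a)"
      "(tau_perm j \<circ> tau_perm i) a = (tau_perm i \<circ> tau_perm j) a"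
      using kl' unfolding kl
      by (cases "a = k"; cases "a = l"; cases "a = Suc k"; cases "a = Suc l";
          simp add: tau_sgn_def)+
  qed
qed

lemma tau_braid:
  assumes i: "i \<in> {1..n}" and j: "j \<in> {1..n}" and ij: "i \<noteq> j"
  shows "alt_prod (Aut_sl (n + 1)) (coxeter_m i j) (tau n i) (tau n j) =
    alt_prod (Aut_sl (n + 1)) (coxeter_m i j) (tau n j) (tau n i)"
proof -
  note t = tau_in_carrier[OF i] tau_in_carrier[OF j]
  note alt = monoid.alt_prod_2[OF monoid_Aut_sl t] monoid.alt_prod_2[OF monoid_Aut_sl t(2) t(1)]
    monoid.alt_prod_3[OF monoid_Aut_sl t] monoid.alt_prod_3[OF monoid_Aut_sl t(2) t(1)]
  consider "j = Suc i" | "i = Suc j" | "j \<noteq> Suc i" "i \<noteq> Suc j"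
    by blast
  then show ?thesis
  proof cases
    case 1
    then have "coxeter_m i j = 3"
      by (simp add: coxeter_m_def)
    then show ?thesis
      unfolding 1 by (simp only: alt[unfolded 1] tau_braid_adjacent[OF i j[unfolded 1]])
  next
    case 2
    then have "coxeter_m i j = 3"
      by (simp add: coxeter_m_def)
    then show ?thesis
      unfolding 2 by (simp only: alt[unfolded 2] tau_braid_adjacent[OF j i[unfolded 2]])
  next
    case 3
    then have "coxeter_m i j = 2"
      by (auto simp: coxeter_m_def)
    then show ?thesis
      by (simp only: alt tau_commute[OF i j ij 3])
  qed
qed

text \<open>Conjugation by s_i swaps the diagonal entries \<open>i - 1\<close> and \<open>i\<close>
  of s_j^2. If i and j are adjacent, exactly one of these entries is -1, so the swap changes both
  signs, which is multiplication by s_i^2. Otherwise both are 1 and s_j^2 is unchanged. The two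
  cases match the exponents 2 and 0.\<close>

lemma tau_conj_sq:
  assumes i: "i \<in> {1..n}" and j: "j \<in> {1..n}" and ij: "i \<noteq> j"
    and a: "(a::int) = (if \<bar>int i - int j\<bar> = 1 then - 1 else 0)"
  shows "tau n i \<otimes>\<^bsub>Aut_sl (n + 1)\<^esub> tau n j [^]\<^bsub>Aut_sl (n + 1)\<^esub> (2::nat)
      \<otimes>\<^bsub>Aut_sl (n + 1)\<^esub> inv\<^bsub>Aut_sl (n + 1)\<^esub> (tau n i) =
    tau n j [^]\<^bsub>Aut_sl (n + 1)\<^esub> (2::nat) \<otimes>\<^bsub>Aut_sl (n + 1)\<^esub> tau n i [^]\<^bsub>Aut_sl (n + 1)\<^esub> (- 2 * a)"
proof -
  obtain k l where kl: "i = Suc k" "j = Suc l"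
    using i j by (cases i; cases j) auto
  note s = signed_perm_tau[OF i] signed_perm_tau_sq[OF j] signed_perm_tau_sq[OF i]
  interpret G: group "Aut_sl (n + 1)"
    by (rule group_Aut_sl)
  note t = tau_in_carrier[OF i] tau_in_carrier[OF j]
  \<comment> \<open>The inverse is first moved to the other side as a factor \<open>tau n i\<close>,
    leaving only products of signed conjugations; \<open>inv_solve_right'\<close> restores it at the
    end.\<close>
  have "tau n i \<otimes>\<^bsub>Aut_sl (n + 1)\<^esub> tau n j [^]\<^bsub>Aut_sl (n + 1)\<^esub> (2::nat) =
    tau n j [^]\<^bsub>Aut_sl (n + 1)\<^esub> (2::nat) \<otimes>\<^bsub>Aut_sl (n + 1)\<^esub> tau n i [^]\<^bsub>Aut_sl (n + 1)\<^esub> (- 2 * a)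
      \<otimes>\<^bsub>Aut_sl (n + 1)\<^esub> tau n i"
  proof (cases "\<bar>int i - int j\<bar> = 1")
    case True
    then have adj: "k = Suc l \<or> l = Suc k"
      using kl by auto
    \<comment> \<open>Writing the exponent as \<open>int 2\<close> lets \<open>int_pow_int\<close>
      turn the integer power into the natural one computed by \<open>tau_sq\<close>.\<close>
    have "- 2 * a = int 2"
      using True a by simp
    then have "tau n i [^]\<^bsub>Aut_sl (n + 1)\<^esub> (- 2 * a) = tau n i [^]\<^bsub>Aut_sl (n + 1)\<^esub> (2::nat)"
      by (simp only: int_pow_int)
    moreover have "tau n i \<otimes>\<^bsub>Aut_sl (n + 1)\<^esub> tau n j [^]\<^bsub>Aut_sl (n + 1)\<^esub> (2::nat) =
        tau n j [^]\<^bsub>Aut_sl (n + 1)\<^esub> (2::nat) \<otimes>\<^bsub>Aut_sl (n + 1)\<^esub> tau n i [^]\<^bsub>Aut_sl (n + 1)\<^esub> (2::nat)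
          \<otimes>\<^bsub>Aut_sl (n + 1)\<^esub> tau n i"
      unfolding tau_sq[OF i] tau_sq[OF j]
      unfolding tau_eq_sconj[OF i] sconj_mult[OF s(1) s(2)]
        sconj_mult[OF s(2) s(3)] sconj_mult[OF signed_perm_comp[OF s(2) s(3)] s(1)]
    proof (rule sconj_cong)
      fix a
      show "tau_sgn i a * (if tau_perm i a + 1 = j \<or> tau_perm i a = j then - 1 else 1) =
          (if a + 1 = j \<or> a = j then - 1 else 1) * (if id a + 1 = i \<or> id a = i then - 1 else 1)
            * tau_sgn i ((id \<circ> id) a)"
        using adj
      proof
        assume l: "k = Suc l"
        show ?thesis
          unfolding kl l
          by (cases "a = l"; cases "a = Suc l"; cases "a = Suc (Suc l)"; simp add: tau_sgn_def)
      next
        assume k: "l = Suc k"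
        show ?thesis
          unfolding kl k
          by (cases "a = k"; cases "a = Suc k"; cases "a = Suc (Suc k)"; simp add: tau_sgn_def)
      qed
    qed simp
    ultimately show ?thesis
      by (simp only:)
  next
    case False
    then have nadj: "k \<noteq> Suc l" "l \<noteq> Suc k" "k \<noteq> l"
      using kl ij by auto
    have "tau n i \<otimes>\<^bsub>Aut_sl (n + 1)\<^esub> tau n j [^]\<^bsub>Aut_sl (n + 1)\<^esub> (2::nat) =
        tau n j [^]\<^bsub>Aut_sl (n + 1)\<^esub> (2::nat) \<otimes>\<^bsub>Aut_sl (n + 1)\<^esub> tau n i"
      unfolding tau_sq[OF j] tau_eq_sconj[OF i] sconj_mult[OF s(1) s(2)] sconj_mult[OF s(2) s(1)]
    proof (rule sconj_cong)
      fix a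
      show "tau_sgn i a * (if tau_perm i a + 1 = j \<or> tau_perm i a = j then - 1 else 1) =
          (if a + 1 = j \<or> a = j then - 1 else 1) * tau_sgn i (id a)"
        using nadj unfolding kl
        by (cases "a = k"; cases "a = l"; cases "a = Suc k"; cases "a = Suc l";
            simp add: tau_sgn_def)
    qed simp
    moreover have "- 2 * a = 0"
      using False a by simp
    ultimately show ?thesis
      by (simp only: int_pow_0 G.r_one[OF G.nat_pow_closed[OF t(2)]])
  qed
  then show ?thesis
    using t by (intro G.inv_solve_right'[THEN iffD2] G.m_closed G.nat_pow_closed G.int_pow_closed)
qed

theorem theorem1p1:
  fixes n :: nat
  assumes "n \<ge> 1"
  defines "G \<equiv> Aut_sl (n + 1)"
  defines "\<tau> \<equiv> tau n"
  shows "(\<forall>i\<in>{1..n}. \<tau> i \<in> carrier G) \<and>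
    (\<forall>i\<in>{1..n}. \<forall>j\<in>{1..n}. i \<noteq> j \<longrightarrow>
       alt_prod G (coxeter_m i j) (\<tau> i) (\<tau> j) = alt_prod G (coxeter_m i j) (\<tau> j) (\<tau> i) \<and>
       \<tau> i [^]\<^bsub>G\<^esub> (2::nat) \<otimes>\<^bsub>G\<^esub> \<tau> j [^]\<^bsub>G\<^esub> (2::nat) = \<tau> j [^]\<^bsub>G\<^esub> (2::nat) \<otimes>\<^bsub>G\<^esub> \<tau> i [^]\<^bsub>G\<^esub> (2::nat) \<and>
       \<tau> i [^]\<^bsub>G\<^esub> (4::nat) = \<one>\<^bsub>G\<^esub> \<and>
       (\<exists>a::int. of_int a = simple_root j (chev_h n i) \<and>
          \<tau> i \<otimes>\<^bsub>G\<^esub> \<tau> j [^]\<^bsub>G\<^esub> (2::nat) \<otimes>\<^bsub>G\<^esub> inv\<^bsub>G\<^esub> (\<tau> i) =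
            \<tau> j [^]\<^bsub>G\<^esub> (2::nat) \<otimes>\<^bsub>G\<^esub> \<tau> i [^]\<^bsub>G\<^esub> (- 2 * a)))"
proof -
  have conj_sq: "\<exists>a::int. of_int a = simple_root j (chev_h n i) \<and>
      \<tau> i \<otimes>\<^bsub>G\<^esub> \<tau> j [^]\<^bsub>G\<^esub> (2::nat) \<otimes>\<^bsub>G\<^esub> inv\<^bsub>G\<^esub> (\<tau> i) =
        \<tau> j [^]\<^bsub>G\<^esub> (2::nat) \<otimes>\<^bsub>G\<^esub> \<tau> i [^]\<^bsub>G\<^esub> (- 2 * a)"
    if "i \<in> {1..n}" "j \<in> {1..n}" "i \<noteq> j" for i j
    unfolding G_def \<tau>_def
    \<comment> \<open>A group exponent has to be an integer, while the root takes a complex value;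
      the witness is the Cartan integer itself.\<close>
    by (intro exI[of _ "if \<bar>int i - int j\<bar> = 1 then - 1 else 0 :: int"] conjI
        tau_conj_sq[OF that refl]) (simp add: simple_root_chev_h[OF that])
  show ?thesis
    unfolding G_def \<tau>_def
    by (intro conjI ballI impI;
        rule tau_in_carrier tau_braid tau_sq_commute tau_pow_4 conj_sq[unfolded G_def \<tau>_def];
        assumption)
qed

end
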